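(* Let $k\ge 1$, $r\ge 2$, and let $\mathcal{C}$ be a systematic $(k+r,k)$ MSR code with node size $\alpha'$ (in the sense of the context). Let $\mathcal{C}_r$ be the $r$-piggybacked $(k+r,k)$ MSR code built from $r$ instances of $\mathcal{C}$, with piggybacks given by injective maps $p_1,\dots,p_r$ as in the context. Its node size is $\alpha=r\alpha'$. Then $\mathcal{C}_r$ has almost optimal repair property, that is: (1) Any single failed systematic node can be repaired with repair bandwidth $\frac{(k+r-1)\alpha}{r}$, which is the optimal value. (2) Any single failed parity node can be repaired with repair bandwidth $\frac{(k+r(r-1))\alpha}{r}$, which is almost optimal: for fixed $r$, its ratio to the optimal value $\frac{(k+r-1)\alpha}{r}$ tends to $1$ as $k\to\infty$.
   Context: All data are vectors over a fixed finite field $\mathbb{F}$, and amounts of data are counted in symbols of $\mathbb{F}$. Systematic $(k+r,k)$ MSR code with node size $\alpha'$ (where $r\mid\alpha'$): there are $k$ systematic nodes storing arbitrary data vectors $\mathbf{f}_1,\dots,\mathbf{f}_k\in\mathbb{F}^{\alpha'}$, and $r$ parity nodes, the $j$th one storing $\mathbf{f}_{k+j}=\sum_{i=1}^k C_{j,i}\mathbf{f}_i$ for fixed $\alpha'\times\alpha'$ matrices $C_{j,i}$ over $\mathbb{F}$. It is assumed that: (a) (MDS property) the contents of any $k$ of the $k+r$ nodes determine $\mathbf{f}_1,\dots,\mathbf{f}_k$; (b) for each $1\le i\le k$ there is an $\frac{\alpha'}{r}\times\alpha'$ repair matrix $S_i$ of rank $\alpha'/r$, depending only on $i$, such that $\mathbf{f}_i$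 is determined by the data $S_i\mathbf{f}_j$, $1\le j\le k+r$, $j\neq i$. Construction of $\mathcal{C}_r$: let $s=r$. Take $s$ independent instances of $\mathcal{C}$, and let $\mathbf{f}_j^{(m)}$ be the content of node $j$ ($1\le j\le k+r$) in instance $m$ ($1\le m\le s$). For each $1\le i\le r$ let $p_i:\{1,\dots,s\}\to\{1,\dots,r\}$ be injective with $p_i(s)=i$, chosen so that the sets $T_l=\{(i',j') : p_{i'}(j')=l,\ 1\le i'\le r,\ 1\le j'<s\}$ satisfy $|T_l|=s-1$ for all $1\le l\le r$. Define the piggybacks $\mathbf{P}_l=\sum_{(i',j')\in T_l}\mathbf{f}_{k+i'}^{(j')}$. In $\mathcal{C}_r$, systematic node $j$ ($1\le j\le k$) stores $(\mathbf{f}_j^{(1)},\dots,\mathbf{f}_j^{(s)})$ and parity node $l$ ($1\le l\le r$) stores $(\mathbf{f}_{k+l}^{(1)},\dots,\mathbf{f}_{k+l}^{(s-1)},\mathbf{f}_{k+l}^{(s)}+\mathbf{P}_l)$. Repair: a failed node is repaired by downloading from each of the $k+r-1$ surviving nodes some symbols that are linear functions of that node's content, and recovering the entire content of the failed node from the downloaded symbols. The repair bandwidth is the total number of downloaded symbols. The "optimal value" is the known lower bound for MSR codes of node size $\alpha$ when all $k+r-1$ surviving nodes help, namely $\frac{k+r-1}{r}\alpha$. *)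

theory Defs
  imports "Jordan_Normal_Form.DL_Rank" "HOL-Library.FuncSet" Complex_Main
begin

text \<open>All indices are 0-based: systematic nodes are \<open>0, \<dots>, k - 1\<close>, parity nodes are
  \<open>k, \<dots>, k + r - 1\<close>, and instances are \<open>0, \<dots>, r - 1\<close>, so the instance that carries
  the piggybacks is number \<open>r - 1\<close>.\<close>

text \<open>The value of \<open>obs\<close> determines the value of \<open>out\<close> as the data range over \<open>X\<close>.\<close>

definition determines :: "'x set \<Rightarrow> ('x \<Rightarrow> 'u) \<Rightarrow> ('x \<Rightarrow> 'v) \<Rightarrow> bool" where
  "determines X obs out \<longleftrightarrow> (\<exists>R. \<forall>x\<in>X. out x = R (obs x))"

definition msr_data :: "nat \<Rightarrow> nat \<Rightarrow> (nat \<Rightarrow> 'a vec) set" where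
  "msr_data k \<alpha>' = ({..<k} \<rightarrow>\<^sub>E carrier_vec \<alpha>')"

definition msr_node ::
  "nat \<Rightarrow> nat \<Rightarrow> (nat \<Rightarrow> nat \<Rightarrow> 'a::field mat) \<Rightarrow> (nat \<Rightarrow> 'a vec) \<Rightarrow> nat \<Rightarrow> 'a vec" where
  "msr_node k \<alpha>' C f j =
     (if j < k then f j
      else finsum_vec TYPE('a) \<alpha>' (\<lambda>i. C (j - k) i *\<^sub>v f i) {..<k})"

definition systematic_msr_code ::
  "nat \<Rightarrow> nat \<Rightarrow> nat \<Rightarrow> (nat \<Rightarrow> nat \<Rightarrow> 'a::field mat) \<Rightarrow> bool" where
  "systematic_msr_code k r \<alpha>' C \<longleftrightarrow>
     r dvd \<alpha>' \<and>
     (\<forall>j<r. \<forall>i<k. C j i \<in> carrier_mat \<alpha>' \<alpha>') \<and>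
     (\<forall>K. K \<subseteq> {..<k + r} \<and> card K = k \<longrightarrow>
        determines (msr_data k \<alpha>') (\<lambda>f. \<lambda>j\<in>K. msr_node k \<alpha>' C f j) (\<lambda>f. f)) \<and>
     (\<forall>i<k. \<exists>S \<in> carrier_mat (\<alpha>' div r) \<alpha>'.
        vec_space.rank (\<alpha>' div r) S = \<alpha>' div r \<and>
        determines (msr_data k \<alpha>')
          (\<lambda>f. \<lambda>j\<in>{..<k + r} - {i}. S *\<^sub>v msr_node k \<alpha>' C f j) (\<lambda>f. f i))"

definition piggyback_set :: "nat \<Rightarrow> (nat \<Rightarrow> nat \<Rightarrow> nat) \<Rightarrow> nat \<Rightarrow> (nat \<times> nat) set" where
  "piggyback_set r p l = {(i, j). i < r \<and> j < r - 1 \<and> p i j = l}"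

definition piggyback_maps :: "nat \<Rightarrow> (nat \<Rightarrow> nat \<Rightarrow> nat) \<Rightarrow> bool" where
  "piggyback_maps r p \<longleftrightarrow>
     (\<forall>i<r. p i \<in> {..<r} \<rightarrow> {..<r} \<and> inj_on (p i) {..<r} \<and> p i (r - 1) = i) \<and>
     (\<forall>l<r. card (piggyback_set r p l) = r - 1)"

definition piggybacked_data :: "nat \<Rightarrow> nat \<Rightarrow> nat \<Rightarrow> (nat \<Rightarrow> nat \<Rightarrow> 'a vec) set" where
  "piggybacked_data k r \<alpha>' = ({..<r} \<rightarrow>\<^sub>E msr_data k \<alpha>')"

definition piggyback ::
  "nat \<Rightarrow> nat \<Rightarrow> nat \<Rightarrow> (nat \<Rightarrow> nat \<Rightarrow> 'a::field mat) \<Rightarrow> (nat \<Rightarrow> nat \<Rightarrow> nat) \<Rightarrow>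
   (nat \<Rightarrow> nat \<Rightarrow> 'a vec) \<Rightarrow> nat \<Rightarrow> 'a vec" where
  "piggyback k r \<alpha>' C p F l =
     finsum_vec TYPE('a) \<alpha>' (\<lambda>(i, j). msr_node k \<alpha>' C (F j) (k + i)) (piggyback_set r p l)"

text \<open>The concatenation of the vectors \<open>v 0, \<dots>, v (n - 1)\<close> of dimension \<open>d\<close>.\<close>

definition concat_vecs :: "nat \<Rightarrow> nat \<Rightarrow> (nat \<Rightarrow> 'a vec) \<Rightarrow> 'a vec" where
  "concat_vecs n d v = vec (n * d) (\<lambda>t. v (t div d) $ (t mod d))"

definition piggybacked_node ::
  "nat \<Rightarrow> nat \<Rightarrow> nat \<Rightarrow> (nat \<Rightarrow> nat \<Rightarrow> 'a::field mat) \<Rightarrow> (nat \<Rightarrow> nat \<Rightarrow> nat) \<Rightarrow>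
   (nat \<Rightarrow> nat \<Rightarrow> 'a vec) \<Rightarrow> nat \<Rightarrow> 'a vec" where
  "piggybacked_node k r \<alpha>' C p F j =
     concat_vecs r \<alpha>' (\<lambda>m.
       if k \<le> j \<and> m = r - 1
       then msr_node k \<alpha>' C (F m) j + piggyback k r \<alpha>' C p F (j - k)
       else msr_node k \<alpha>' C (F m) j)"

text \<open>A code with \<open>n\<close> nodes of size \<open>\<alpha>\<close> is given by the set \<open>X\<close> of data and the content
  \<open>node x j\<close> of each node. In a repair scheme for node \<open>e\<close>, a surviving node \<open>j\<close> sends the
  linear image of its content under \<open>D j\<close>; the number of rows of \<open>D j\<close> is arbitrary and is the
  number of symbols downloaded from \<open>j\<close>.\<close>

definition repair_scheme ::
  "'x set \<Rightarrow> nat \<Rightarrow> nat \<Rightarrow> ('x \<Rightarrow> nat \<Rightarrow> 'a::field vec) \<Rightarrow> nat \<Rightarrow> (nat \<Rightarrow> 'a mat) \<Rightarrow> bool" where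
  "repair_scheme X n \<alpha> node e D \<longleftrightarrow>
     (\<forall>j\<in>{..<n} - {e}. dim_col (D j) = \<alpha>) \<and>
     determines X (\<lambda>x. \<lambda>j\<in>{..<n} - {e}. D j *\<^sub>v node x j) (\<lambda>x. node x e)"

definition repair_bandwidth :: "nat \<Rightarrow> nat \<Rightarrow> (nat \<Rightarrow> 'a mat) \<Rightarrow> nat" where
  "repair_bandwidth n e D = (\<Sum>j\<in>{..<n} - {e}. dim_row (D j))"

text \<open>The cut-set lower bound on the repair bandwidth of a \<open>(k + r, k)\<close> MSR code of node size
  \<open>\<alpha>\<close> when all \<open>k + r - 1\<close> surviving nodes help.\<close>

definition optimal_bandwidth :: "nat \<Rightarrow> nat \<Rightarrow> nat \<Rightarrow> real" where
  "optimal_bandwidth k r \<alpha> = (real k + real r - 1) * real \<alpha> / real r"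

end

theory Submission
  imports Defs "HOL-Real_Asymp.Real_Asymp"
begin

text \<open>Systematic node \<open>i\<close>: every survivor applies the repair matrix \<open>S i\<close> of the
  base code to each of its instances. The first \<open>r - 1\<close> instances carry no piggyback, and the
  piggybacks only involve parity symbols of these instances, so the \<open>S i\<close>-image of each piggyback
  is already among the downloads and can be subtracted from the last instance.

  Parity node \<open>l\<close>: download the last instance of all systematic nodes and the other parity nodes
  completely. The last instance is then known. As \<open>p l\<close> is injective with \<open>p l (r - 1) = l\<close>, the
  piggyback of node \<open>l\<close> involves only other parity nodes, and each of the first \<open>r - 1\<close> instances of
  node \<open>l\<close> is the only unknown summand of the piggyback of some other parity node.\<close>

section \<open>Determination and finite sums of vectors\<close>

text \<open>A decoder evaluates \<open>out\<close> at any chosen datum of \<open>X\<close> with the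
  given observation; this is correct because \<open>out\<close> is constant on the fibres of
  \<open>obs\<close>. Repair proofs thus reduce to comparing two data \<open>F\<close> and
  \<open>G\<close> with equal downloads.\<close>

lemma determinesI:
  assumes "\<And>x y. x \<in> X \<Longrightarrow> y \<in> X \<Longrightarrow> obs x = obs y \<Longrightarrow> out x = out y"
  shows "determines X obs out"
  unfolding determines_def
proof (intro exI ballI)
  fix x assume x: "x \<in> X"
  have "(SOME y. y \<in> X \<and> obs y = obs x) \<in> X \<and> obs (SOME y. y \<in> X \<and> obs y = obs x) = obs x"
    by (rule someI[where x = x]) (use x in simp)
  with x assms show "out x = (\<lambda>u. out (SOME y. y \<in> X \<and> obs y = u)) (obs x)"
    by metis
qed

lemma determinesD:
  assumes "determines X obs out" "x \<in> X" "y \<in> X" "obs x = obs y"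
  shows "out x = out y"
  using assms unfolding determines_def by metis

lemma finsum_vec_carrier:
  fixes f :: "'b \<Rightarrow> 'a::comm_monoid_add vec"
  assumes "\<And>x. x \<in> T \<Longrightarrow> f x \<in> carrier_vec n"
  shows "finsum_vec TYPE('a) n f T \<in> carrier_vec n"
  by (rule finsum_vec_closed) (use assms in auto)

lemma finsum_vec_cong:
  fixes f g :: "'b \<Rightarrow> 'a::comm_monoid_add vec"
  assumes "\<And>x. x \<in> T \<Longrightarrow> f x = g x" "\<And>x. x \<in> T \<Longrightarrow> g x \<in> carrier_vec n"
  shows "finsum_vec TYPE('a) n f T = finsum_vec TYPE('a) n g T"
  unfolding finsum_vec_def
  by (rule comm_monoid.finprod_cong'[OF comm_monoid_vec])
     (use assms in \<open>auto simp: monoid_vec_simps\<close>)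

lemma mult_mat_vec_finsum_vec:
  fixes S :: "'a::comm_ring_1 mat"
  assumes "finite T" "S \<in> carrier_mat m n" "\<And>x. x \<in> T \<Longrightarrow> f x \<in> carrier_vec n"
  shows "S *\<^sub>v finsum_vec TYPE('a) n f T = finsum_vec TYPE('a) m (\<lambda>x. S *\<^sub>v f x) T"
  using assms(1,3)
proof (induction T)
  case empty
  show ?case using assms(2) by (auto simp: finsum_vec_empty)
next
  case (insert x T)
  have f: "f \<in> T \<rightarrow> carrier_vec n" "f x \<in> carrier_vec n" using insert.prems by auto
  have Sf: "(\<lambda>x. S *\<^sub>v f x) \<in> T \<rightarrow> carrier_vec m" "S *\<^sub>v f x \<in> carrier_vec m"
    using insert.prems assms(2) by (auto intro!: mult_mat_vec_carrier)
  show ?case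
    using insert.IH insert.prems
    by (simp add: finsum_vec_insert[OF insert.hyps f] finsum_vec_insert[OF insert.hyps Sf]
        mult_add_distrib_mat_vec[OF assms(2) f(2) finsum_vec_closed[OF f(1)]])
qed

lemma add_right_cancel_vec:
  fixes u v w :: "'a::cancel_semigroup_add vec"
  assumes "u + w = v + w" "u \<in> carrier_vec n" "v \<in> carrier_vec n" "w \<in> carrier_vec n"
  shows "u = v"
proof (rule eq_vecI)
  fix i assume i: "i < dim_vec v"
  have "(u + w) $ i = (v + w) $ i" by (simp add: assms(1))
  then show "u $ i = v $ i" using i assms(2-4) by simp
qed (use assms in simp)

lemma add_left_cancel_vec:
  fixes u v w :: "'a::cancel_semigroup_add vec"
  assumes "w + u = w + v" "u \<in> carrier_vec n" "v \<in> carrier_vec n" "w \<in> carrier_vec n"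
  shows "u = v"
proof (rule eq_vecI)
  fix i assume i: "i < dim_vec v"
  have "(w + u) $ i = (w + v) $ i" by (simp add: assms(1))
  then show "u $ i = v $ i" using i assms(2-4) by simp
qed (use assms in simp)

section \<open>Concatenated vectors and their blocks\<close>

lemma block_index:
  fixes m s d n :: nat
  assumes "m < n" "s < d"
  shows "m * d + s < n * d" "(m * d + s) div d = m" "(m * d + s) mod d = s"
proof -
  have "m * d + s < Suc m * d" using assms(2) by simp
  also have "\<dots> \<le> n * d" using assms(1) by (intro mult_le_mono1) simp
  finally show "m * d + s < n * d" .
qed (use assms in auto)

lemma concat_vecs_carrier: "concat_vecs n d v \<in> carrier_vec (n * d)"
  by (simp add: concat_vecs_def)

lemma concat_vecs_index:
  assumes "m < n" "s < d"
  shows "concat_vecs n d v $ (m * d + s) = v m $ s"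
  using assms by (simp add: concat_vecs_def block_index)

lemma concat_vecs_eqI:
  assumes "\<And>m. m < n \<Longrightarrow> v m = w m"
  shows "concat_vecs n d v = concat_vecs n d w"
  unfolding concat_vecs_def
  by (rule vec_eq_iff[THEN iffD2]) (auto simp: assms less_mult_imp_div_less)

text \<open>The dimensions of the blocks matter: a concatenation records only the first
  \<open>d\<close> entries of each.\<close>

lemma concat_vecs_eqD:
  assumes "concat_vecs n d v = concat_vecs n d w" "m < n"
    and "v m \<in> carrier_vec d" "w m \<in> carrier_vec d"
  shows "v m = w m"
proof (rule eq_vecI)
  fix s assume "s < dim_vec (w m)"
  then have s: "s < d" using assms(4) by simp
  show "v m $ s = w m $ s"
    using concat_vecs_index[OF assms(2) s, of v] concat_vecs_index[OF assms(2) s, of w] assms(1)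
    by simp
qed (use assms in simp)

lemma scalar_prod_concat_vecs:
  "x \<bullet> concat_vecs n d v = (\<Sum>m<n. \<Sum>s<d. x $ (m * d + s) * v m $ s)"
proof -
  have "x \<bullet> concat_vecs n d v = (\<Sum>c<n * d. x $ c * concat_vecs n d v $ c)"
    by (simp add: scalar_prod_def concat_vecs_def atLeast0LessThan)
  also have "\<dots> = (\<Sum>m<n. \<Sum>c\<in>{m * d..<m * d + d}. x $ c * concat_vecs n d v $ c)"
    by (rule sum.nat_group[symmetric])
  also have "\<dots> = (\<Sum>m<n. \<Sum>s<d. x $ (m * d + s) * v m $ s)"
  proof (rule sum.cong[OF refl])
    fix m assume m: "m \<in> {..<n}"
    have "(\<Sum>c\<in>{m * d..<m * d + d}. x $ c * concat_vecs n d v $ c)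
        = (\<Sum>s<d. x $ (m * d + s) * concat_vecs n d v $ (m * d + s))"
      using sum.shift_bounds_nat_ivl[of "\<lambda>c. x $ c * concat_vecs n d v $ c" 0 "m * d" d]
      by (simp add: atLeast0LessThan add.commute)
    with m show "(\<Sum>c\<in>{m * d..<m * d + d}. x $ c * concat_vecs n d v $ c)
        = (\<Sum>s<d. x $ (m * d + s) * v m $ s)"
      by (simp add: concat_vecs_index)
  qed
  finally show ?thesis .
qed

section \<open>Block matrices that act on concatenations\<close>

text \<open>This is the Kronecker product of the identity of size \<open>n\<close> with
  \<open>S\<close>; it applies \<open>S\<close> to every instance separately.\<close>

definition block_diag_mat :: "nat \<Rightarrow> 'a::semiring_0 mat \<Rightarrow> 'a mat" where
  "block_diag_mat n S = mat (n * dim_row S) (n * dim_col S)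
     (\<lambda>(a, c). if a div dim_row S = c div dim_col S
               then S $$ (a mod dim_row S, c mod dim_col S) else 0)"

lemma block_diag_mat_mult_concat_vecs:
  assumes "S \<in> carrier_mat b d" "\<And>m. m < n \<Longrightarrow> v m \<in> carrier_vec d"
  shows "block_diag_mat n S *\<^sub>v concat_vecs n d v = concat_vecs n b (\<lambda>m. S *\<^sub>v v m)"
proof (rule eq_vecI)
  fix a assume "a < dim_vec (concat_vecs n b (\<lambda>m. S *\<^sub>v v m))"
  then have a: "a < n * b" by (simp add: concat_vecs_def)
  \<comment> \<open>For \<open>b = 0\<close> there is no row \<open>a\<close> at all; positivity
    makes \<open>a mod b\<close> a row index of \<open>S\<close>.\<close>
  then have b: "b > 0" by (cases b) auto
  let ?q = "a div b" and ?t = "a mod b"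
  have q: "?q < n" "?t < b" using a b by (auto simp: less_mult_imp_div_less)
  have "(block_diag_mat n S *\<^sub>v concat_vecs n d v) $ a = row (block_diag_mat n S) a \<bullet> concat_vecs n d v"
    using a assms(1) by (simp add: block_diag_mat_def)
  also have "\<dots> = (\<Sum>m<n. \<Sum>s<d. row (block_diag_mat n S) a $ (m * d + s) * v m $ s)"
    by (rule scalar_prod_concat_vecs)
  \<comment> \<open>Row \<open>a\<close> lies in block row \<open>?q\<close> and vanishes outside
    the columns of block \<open>?q\<close>, so a single block contributes.\<close>
  also have "\<dots> = (\<Sum>m<n. if m = ?q then \<Sum>s<d. S $$ (?t, s) * v ?q $ s else 0)"
  proof (rule sum.cong[OF refl])
    fix m assume m: "m \<in> {..<n}"
    have "row (block_diag_mat n S) a $ (m * d + s) = (if m = ?q then S $$ (?t, s) else 0)"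
      if "s < d" for s
      using m that a assms(1) by (auto simp: block_diag_mat_def block_index)
    then show "(\<Sum>s<d. row (block_diag_mat n S) a $ (m * d + s) * v m $ s)
        = (if m = ?q then \<Sum>s<d. S $$ (?t, s) * v ?q $ s else 0)"
      by auto
  qed
  also have "\<dots> = (S *\<^sub>v v ?q) $ ?t"
    using q assms(1) assms(2)[OF q(1)] by (simp add: scalar_prod_def atLeast0LessThan)
  also have "\<dots> = concat_vecs n b (\<lambda>m. S *\<^sub>v v m) $ a"
    using a by (simp add: concat_vecs_def)
  finally show "(block_diag_mat n S *\<^sub>v concat_vecs n d v) $ a
      = concat_vecs n b (\<lambda>m. S *\<^sub>v v m) $ a" .
qed (use assms in \<open>simp add: block_diag_mat_def concat_vecs_def\<close>)

text \<open>The projection onto block \<open>q\<close>: its rows are unit vectors, and there are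
  \<open>d\<close> of them, so fetching one instance costs \<open>d\<close> symbols.\<close>

definition block_select_mat :: "nat \<Rightarrow> nat \<Rightarrow> nat \<Rightarrow> 'a::semiring_1 mat" where
  "block_select_mat n d q = mat d (n * d) (\<lambda>(a, c). if c = q * d + a then 1 else 0)"

lemma block_select_mat_mult_concat_vecs:
  assumes "q < n" "v q \<in> carrier_vec d"
  shows "block_select_mat n d q *\<^sub>v concat_vecs n d v = v q"
proof (rule eq_vecI)
  fix a assume "a < dim_vec (v q)"
  then have a: "a < d" using assms by simp
  have "(block_select_mat n d q *\<^sub>v concat_vecs n d v) $ a
      = (\<Sum>c<n * d. if c = q * d + a then concat_vecs n d v $ c else 0)"
    using a block_index(1)[OF assms(1) a]
    by (simp add: block_select_mat_def scalar_prod_def carrier_vecD[OF concat_vecs_carrier]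
        atLeast0LessThan if_distrib[of "\<lambda>x. x * _"] cong: if_cong)
  also have "\<dots> = v q $ a"
    using a assms(1) by (simp add: block_index concat_vecs_index)
  finally show "(block_select_mat n d q *\<^sub>v concat_vecs n d v) $ a = v q $ a" .
qed (use assms in \<open>simp add: block_select_mat_def\<close>)

section \<open>Node contents and piggybacks\<close>

lemma msr_node_carrier:
  assumes "systematic_msr_code k r \<alpha>' C" "f \<in> msr_data k \<alpha>'" "j < k + r"
  shows "msr_node k \<alpha>' C f j \<in> carrier_vec \<alpha>'"
proof (cases "j < k")
  case True
  then show ?thesis using assms(2) by (auto simp: msr_node_def msr_data_def)
next
  case False
  have "C (j - k) i \<in> carrier_mat \<alpha>' \<alpha>'" if "i < k" for i
    using False assms that unfolding systematic_msr_code_def by auto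
  moreover have "f i \<in> carrier_vec \<alpha>'" if "i < k" for i
    using that assms(2) by (auto simp: msr_data_def)
  ultimately show ?thesis
    using False by (auto simp: msr_node_def intro!: finsum_vec_carrier mult_mat_vec_carrier)
qed

lemma instance_node_carrier:
  assumes "systematic_msr_code k r \<alpha>' C" "F \<in> piggybacked_data k r \<alpha>'" "j < k + r" "m < r"
  shows "msr_node k \<alpha>' C (F m) j \<in> carrier_vec \<alpha>'"
proof (rule msr_node_carrier[OF assms(1) _ assms(3)])
  show "F m \<in> msr_data k \<alpha>'"
    using assms(2,4) unfolding piggybacked_data_def by (auto dest: PiE_mem)
qed

lemma finite_piggyback_set: "finite (piggyback_set r p l)"
  by (rule finite_subset[of _ "{..<r} \<times> {..<r}"]) (auto simp: piggyback_set_def)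

lemma piggyback_carrier:
  assumes "systematic_msr_code k r \<alpha>' C" "F \<in> piggybacked_data k r \<alpha>'"
  shows "piggyback k r \<alpha>' C p F l \<in> carrier_vec \<alpha>'"
  unfolding piggyback_def
  by (rule finsum_vec_carrier)
     (auto simp: piggyback_set_def intro!: instance_node_carrier[OF assms])

text \<open>\<open>S\<close> distributes over the finite sum that defines the piggyback. In
  systematic repair only images under \<open>S\<close> of the summands are known, not the summands
  themselves.\<close>

lemma piggyback_eqI:
  assumes "systematic_msr_code k r \<alpha>' C"
    and "F \<in> piggybacked_data k r \<alpha>'" "G \<in> piggybacked_data k r \<alpha>'"
    and "S \<in> carrier_mat b \<alpha>'"
    and "\<And>i j. (i, j) \<in> piggyback_set r p l \<Longrightarrow>
      S *\<^sub>v msr_node k \<alpha>' C (F j) (k + i) = S *\<^sub>v msr_node k \<alpha>' C (G j) (k + i)"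
  shows "S *\<^sub>v piggyback k r \<alpha>' C p F l = S *\<^sub>v piggyback k r \<alpha>' C p G l"
proof -
  have car: "msr_node k \<alpha>' C (H j) (k + i) \<in> carrier_vec \<alpha>'"
    if "H \<in> piggybacked_data k r \<alpha>'" "(i, j) \<in> piggyback_set r p l" for H i j
    using that(2) by (auto simp: piggyback_set_def intro!: instance_node_carrier[OF assms(1) that(1)])
  have expand: "S *\<^sub>v piggyback k r \<alpha>' C p H l
      = finsum_vec TYPE('a) b (\<lambda>x. S *\<^sub>v (case x of (i, j) \<Rightarrow> msr_node k \<alpha>' C (H j) (k + i)))
          (piggyback_set r p l)"
    if "H \<in> piggybacked_data k r \<alpha>'" for H
    unfolding piggyback_def
    by (rule mult_mat_vec_finsum_vec[OF finite_piggyback_set assms(4)]) (use car that in auto)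
  show ?thesis
    unfolding expand[OF assms(2)] expand[OF assms(3)]
    by (rule finsum_vec_cong) (use assms(4,5) car[OF assms(3)] in \<open>auto intro!: mult_mat_vec_carrier\<close>)
qed

text \<open>The function under the concatenation in \<open>piggybacked_node\<close> gets a name, so
  that equalities and dimensions can be stated per instance.\<close>

definition piggybacked_block ::
  "nat \<Rightarrow> nat \<Rightarrow> nat \<Rightarrow> (nat \<Rightarrow> nat \<Rightarrow> 'a::field mat) \<Rightarrow> (nat \<Rightarrow> nat \<Rightarrow> nat) \<Rightarrow>
   (nat \<Rightarrow> nat \<Rightarrow> 'a vec) \<Rightarrow> nat \<Rightarrow> nat \<Rightarrow> 'a vec" where
  "piggybacked_block k r \<alpha>' C p F j m =
     (if k \<le> j \<and> m = r - 1
      then msr_node k \<alpha>' C (F m) j + piggyback k r \<alpha>' C p F (j - k)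
      else msr_node k \<alpha>' C (F m) j)"

lemma piggybacked_node_eq:
  "piggybacked_node k r \<alpha>' C p F j = concat_vecs r \<alpha>' (piggybacked_block k r \<alpha>' C p F j)"
  by (simp add: piggybacked_node_def piggybacked_block_def[abs_def])

lemma piggybacked_block_carrier:
  assumes "systematic_msr_code k r \<alpha>' C" "F \<in> piggybacked_data k r \<alpha>'" "j < k + r" "m < r"
  shows "piggybacked_block k r \<alpha>' C p F j m \<in> carrier_vec \<alpha>'"
  using instance_node_carrier[OF assms] piggyback_carrier[OF assms(1,2), of p "j - k"]
  by (cases "k \<le> j \<and> m = r - 1") (auto simp: piggybacked_block_def intro!: add_carrier_vec)

section \<open>Repair of a systematic node\<close>

lemma systematic_repair:
  fixes C :: "nat \<Rightarrow> nat \<Rightarrow> 'a::field mat"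
  assumes code: "systematic_msr_code k r \<alpha>' C" and i: "i < k" and r: "r > 0"
  shows "\<exists>D. repair_scheme (piggybacked_data k r \<alpha>') (k + r) (r * \<alpha>')
             (piggybacked_node k r \<alpha>' C p) i D
           \<and> repair_bandwidth (k + r) i D = (k + r - 1) * \<alpha>'"
proof -
  have dv: "r dvd \<alpha>'" using code by (simp add: systematic_msr_code_def)
  obtain S where S: "S \<in> carrier_mat (\<alpha>' div r) \<alpha>'"
    and det: "determines (msr_data k \<alpha>')
          (\<lambda>f. \<lambda>j\<in>{..<k + r} - {i}. S *\<^sub>v msr_node k \<alpha>' C f j) (\<lambda>f. f i)"
    using code i unfolding systematic_msr_code_def by blast
  \<comment> \<open>One matrix serves all survivors, since \<open>S\<close> depends only on the
    failed node.\<close>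
  define D where "D = (\<lambda>j::nat. block_diag_mat r S)"
  have "repair_scheme (piggybacked_data k r \<alpha>') (k + r) (r * \<alpha>') (piggybacked_node k r \<alpha>' C p) i D"
    unfolding repair_scheme_def
  proof (intro conjI ballI determinesI)
    fix j show "dim_col (D j) = r * \<alpha>'" using S by (simp add: D_def block_diag_mat_def)
  next
    fix F G
    assume F: "F \<in> piggybacked_data k r \<alpha>'" and G: "G \<in> piggybacked_data k r \<alpha>'"
      and eq: "(\<lambda>j\<in>{..<k + r} - {i}. D j *\<^sub>v piggybacked_node k r \<alpha>' C p F j)
             = (\<lambda>j\<in>{..<k + r} - {i}. D j *\<^sub>v piggybacked_node k r \<alpha>' C p G j)"
    have block: "S *\<^sub>v piggybacked_block k r \<alpha>' C p F j m = S *\<^sub>v piggybacked_block k r \<alpha>' C p G j m"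
      if j: "j < k + r" "j \<noteq> i" and m: "m < r" for j m
    proof -
      have "D j *\<^sub>v piggybacked_node k r \<alpha>' C p F j = D j *\<^sub>v piggybacked_node k r \<alpha>' C p G j"
        using fun_cong[OF eq, of j] j by simp
      moreover have "D j *\<^sub>v piggybacked_node k r \<alpha>' C p H j
          = concat_vecs r (\<alpha>' div r) (\<lambda>m. S *\<^sub>v piggybacked_block k r \<alpha>' C p H j m)"
        if "H \<in> piggybacked_data k r \<alpha>'" for H
        unfolding D_def piggybacked_node_eq
        by (rule block_diag_mat_mult_concat_vecs[OF S])
           (use code that j in \<open>auto intro!: piggybacked_block_carrier\<close>)
      ultimately have "concat_vecs r (\<alpha>' div r) (\<lambda>m. S *\<^sub>v piggybacked_block k r \<alpha>' C p F j m)
          = concat_vecs r (\<alpha>' div r) (\<lambda>m. S *\<^sub>v piggybacked_block k r \<alpha>' C p G j m)"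
        using F G by simp
      from concat_vecs_eqD[OF this m] S show ?thesis
        by (simp add: mult_mat_vec_carrier piggybacked_block_carrier[OF code F j(1) m]
            piggybacked_block_carrier[OF code G j(1) m])
    qed
    note car = instance_node_carrier[OF code]
    \<comment> \<open>The piggybacks are now stripped, which brings the comparison down to single
      instances of the base code.\<close>
    have node: "S *\<^sub>v msr_node k \<alpha>' C (F m) j = S *\<^sub>v msr_node k \<alpha>' C (G m) j"
      if j: "j < k + r" "j \<noteq> i" and m: "m < r" for j m
    proof (cases "k \<le> j \<and> m = r - 1")
      case False
      then show ?thesis using block[OF that] by (auto simp: piggybacked_block_def)
    next
      case True
      let ?P = "\<lambda>H. piggyback k r \<alpha>' C p H (j - k)"
      \<comment> \<open>Every summand belongs to an instance \<open>j' < r - 1\<close>, where parity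
        blocks are bare, and to a node \<open>k + i'\<close> that differs from \<open>i\<close>
        because \<open>i < k\<close>; hence \<open>block\<close> applies.\<close>
      have P: "S *\<^sub>v ?P F = S *\<^sub>v ?P G"
      proof (rule piggyback_eqI[OF code F G S])
        fix i' j' assume "(i', j') \<in> piggyback_set r p (j - k)"
        then have ij: "i' < r" "j' < r - 1" by (auto simp: piggyback_set_def)
        then show "S *\<^sub>v msr_node k \<alpha>' C (F j') (k + i') = S *\<^sub>v msr_node k \<alpha>' C (G j') (k + i')"
          using block[of "k + i'" j'] i by (auto simp: piggybacked_block_def)
      qed
      \<comment> \<open>By \<open>P\<close> the image of the piggyback of \<open>G\<close> may be
        replaced by that of \<open>F\<close>, which gives both sides a common summand to
        cancel.\<close>
      have "S *\<^sub>v msr_node k \<alpha>' C (F m) j + S *\<^sub>v ?P F = S *\<^sub>v msr_node k \<alpha>' C (G m) j + S *\<^sub>v ?P F"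
        using block[OF that] True P
          mult_add_distrib_mat_vec[OF S car[OF F j(1) m] piggyback_carrier[OF code F]]
          mult_add_distrib_mat_vec[OF S car[OF G j(1) m] piggyback_carrier[OF code G]]
        by (simp add: piggybacked_block_def)
      then show ?thesis
        by (rule add_right_cancel_vec)
           (use S car[OF F j(1) m] car[OF G j(1) m] piggyback_carrier[OF code F]
            in \<open>auto intro!: mult_mat_vec_carrier\<close>)
    qed
    \<comment> \<open>Each instance is repaired on its own by the repair property of the base
      code.\<close>
    have data: "F m i = G m i" if m: "m < r" for m
    proof (rule determinesD[OF det])
      show "F m \<in> msr_data k \<alpha>'" "G m \<in> msr_data k \<alpha>'"
        using F G m by (auto simp: piggybacked_data_def)
      show "(\<lambda>j\<in>{..<k + r} - {i}. S *\<^sub>v msr_node k \<alpha>' C (F m) j)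
          = (\<lambda>j\<in>{..<k + r} - {i}. S *\<^sub>v msr_node k \<alpha>' C (G m) j)"
        using node m by (auto intro!: restrict_ext)
    qed
    show "piggybacked_node k r \<alpha>' C p F i = piggybacked_node k r \<alpha>' C p G i"
      unfolding piggybacked_node_eq
      by (rule concat_vecs_eqI) (use i data in \<open>simp add: piggybacked_block_def msr_node_def\<close>)
  qed
  \<comment> \<open>Each of the \<open>k + r - 1\<close> survivors sends \<open>r\<close> blocks of
    \<open>\<alpha>' div r\<close> symbols, which is \<alpha>' symbols since
    \<open>r dvd \<alpha>'\<close>.\<close>
  moreover have "repair_bandwidth (k + r) i D = (k + r - 1) * \<alpha>'"
    using i S dv by (simp add: repair_bandwidth_def D_def block_diag_mat_def)
  ultimately show ?thesis by blast
qed

section \<open>Repair of a parity node\<close>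

text \<open>When parity node \<open>l\<close> is repaired, its own symbols are the only summands of a piggyback that
  are not downloaded.\<close>

lemma piggyback_remove:
  fixes C :: "nat \<Rightarrow> nat \<Rightarrow> 'a::field mat"
  assumes "systematic_msr_code k r \<alpha>' C" "F \<in> piggybacked_data k r \<alpha>'"
    and "(l, j) \<in> piggyback_set r p q"
  shows "piggyback k r \<alpha>' C p F q = msr_node k \<alpha>' C (F j) (k + l) +
     finsum_vec TYPE('a) \<alpha>' (\<lambda>(i, j). msr_node k \<alpha>' C (F j) (k + i)) (piggyback_set r p q - {(l, j)})"
proof -
  let ?T = "piggyback_set r p q" and ?f = "\<lambda>(i, j). msr_node k \<alpha>' C (F j) (k + i)"
  have car: "?f x \<in> carrier_vec \<alpha>'" if "x \<in> ?T" for x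
    using that by (auto simp: piggyback_set_def intro!: instance_node_carrier[OF assms(1,2)])
  have f: "?f \<in> ?T - {(l, j)} \<rightarrow> carrier_vec \<alpha>'" using car by blast
  have "finsum_vec TYPE('a) \<alpha>' ?f (insert (l, j) (?T - {(l, j)}))
      = ?f (l, j) + finsum_vec TYPE('a) \<alpha>' ?f (?T - {(l, j)})"
    by (rule finsum_vec_insert) (use f car[OF assms(3)] finite_piggyback_set in auto)
  then show ?thesis using assms(3) by (simp add: piggyback_def insert_absorb)
qed

lemma parity_repair:
  fixes C :: "nat \<Rightarrow> nat \<Rightarrow> 'a::field mat"
  assumes code: "systematic_msr_code k r \<alpha>' C" and p: "piggyback_maps r p" and l: "l < r"
  shows "\<exists>D. repair_scheme (piggybacked_data k r \<alpha>') (k + r) (r * \<alpha>')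
             (piggybacked_node k r \<alpha>' C p) (k + l) D
           \<and> repair_bandwidth (k + r) (k + l) D = k * \<alpha>' + (r - 1) * (r * \<alpha>')"
proof -
  have pl: "p l \<in> {..<r} \<rightarrow> {..<r}" "inj_on (p l) {..<r}" "p l (r - 1) = l"
    using p l by (auto simp: piggyback_maps_def)
  define D :: "nat \<Rightarrow> 'a mat" where
    "D = (\<lambda>j. if j < k then block_select_mat r \<alpha>' (r - 1) else 1\<^sub>m (r * \<alpha>'))"
  have "repair_scheme (piggybacked_data k r \<alpha>') (k + r) (r * \<alpha>')
      (piggybacked_node k r \<alpha>' C p) (k + l) D"
    unfolding repair_scheme_def
  proof (intro conjI ballI determinesI)
    fix j show "dim_col (D j) = r * \<alpha>'" by (simp add: D_def block_select_mat_def)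
  next
    fix F G
    assume F: "F \<in> piggybacked_data k r \<alpha>'" and G: "G \<in> piggybacked_data k r \<alpha>'"
      and eq: "(\<lambda>j\<in>{..<k + r} - {k + l}. D j *\<^sub>v piggybacked_node k r \<alpha>' C p F j)
             = (\<lambda>j\<in>{..<k + r} - {k + l}. D j *\<^sub>v piggybacked_node k r \<alpha>' C p G j)"
    have dl: "D j *\<^sub>v piggybacked_node k r \<alpha>' C p F j = D j *\<^sub>v piggybacked_node k r \<alpha>' C p G j"
      if "j < k + r" "j \<noteq> k + l" for j
      using fun_cong[OF eq, of j] that by simp
    note car = instance_node_carrier[OF code]
    have data: "F (r - 1) j = G (r - 1) j" if j: "j < k" for j
    proof -
      have "D j *\<^sub>v piggybacked_node k r \<alpha>' C p H j = H (r - 1) j"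
        if H: "H \<in> piggybacked_data k r \<alpha>'" for H
      proof -
        have "D j *\<^sub>v piggybacked_node k r \<alpha>' C p H j = piggybacked_block k r \<alpha>' C p H j (r - 1)"
          unfolding piggybacked_node_eq D_def using j l
          by (simp add: block_select_mat_mult_concat_vecs piggybacked_block_carrier[OF code H])
        then show ?thesis using j by (simp add: piggybacked_block_def msr_node_def)
      qed
      then show ?thesis using dl[of j] F G j by simp
    qed
    \<comment> \<open>Data are extensional functions, so agreement on the systematic nodes makes the
      whole last instance equal, including the lost parity symbol in it.\<close>
    have last: "F (r - 1) = G (r - 1)"
      by (rule PiE_ext[of _ "{..<k}" "\<lambda>_. carrier_vec \<alpha>'"])
         (use F G l data in \<open>auto simp: piggybacked_data_def msr_data_def PiE_mem\<close>)
    have block: "piggybacked_block k r \<alpha>' C p F (k + q) m = piggybacked_block k r \<alpha>' C p G (k + q) m"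
      if q: "q < r" "q \<noteq> l" and m: "m < r" for q m
    proof -
      have "piggybacked_node k r \<alpha>' C p F (k + q) = piggybacked_node k r \<alpha>' C p G (k + q)"
        using dl[of "k + q"] q by (simp add: D_def piggybacked_node_eq
            one_mult_mat_vec[OF concat_vecs_carrier])
      then show ?thesis
        unfolding piggybacked_node_eq
        by (rule concat_vecs_eqD[OF _ m]) (use code F G q m in \<open>auto intro!: piggybacked_block_carrier\<close>)
    qed
    have node: "msr_node k \<alpha>' C (F m) (k + q) = msr_node k \<alpha>' C (G m) (k + q)"
      if "q < r" "q \<noteq> l" "m < r - 1" for q m
      using block[of q m] that by (simp add: piggybacked_block_def)
    \<comment> \<open>The last block of a surviving parity node is its symbol in the known last
      instance plus its piggyback, so the piggyback can be isolated.\<close>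
    have P_other: "piggyback k r \<alpha>' C p F q = piggyback k r \<alpha>' C p G q" if q: "q < r" "q \<noteq> l" for q
    proof -
      have "msr_node k \<alpha>' C (G (r - 1)) (k + q) + piggyback k r \<alpha>' C p F q
          = msr_node k \<alpha>' C (G (r - 1)) (k + q) + piggyback k r \<alpha>' C p G q"
        using block[OF q, of "r - 1"] q last by (simp add: piggybacked_block_def)
      then show ?thesis
        by (rule add_left_cancel_vec)
           (use car[OF G] q piggyback_carrier[OF code F] piggyback_carrier[OF code G] in auto)
    qed
    have inst: "msr_node k \<alpha>' C (F m) (k + l) = msr_node k \<alpha>' C (G m) (k + l)" if m: "m < r" for m
    proof (cases "m = r - 1")
      case True
      then show ?thesis using last by simp
    next
      case False
      then have m': "m < r - 1" using m by simp
      let ?q = "p l m"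
      \<comment> \<open>\<open>p l\<close> takes the value \<open>l\<close> at \<open>r - 1\<close>
        and is injective, so it avoids \<open>l\<close> at \<open>m\<close>; the lost symbol
        therefore sits in the piggyback of a survivor.\<close>
      have q: "?q < r" "?q \<noteq> l"
        using pl m m' by (auto dest: inj_onD[of _ _ m "r - 1"])
      have lm: "(l, m) \<in> piggyback_set r p ?q" using l m' by (simp add: piggyback_set_def)
      let ?R = "\<lambda>H. finsum_vec TYPE('a) \<alpha>' (\<lambda>(i, j). msr_node k \<alpha>' C (H j) (k + i))
          (piggyback_set r p ?q - {(l, m)})"
      have R_car: "?R G \<in> carrier_vec \<alpha>'"
        by (rule finsum_vec_carrier) (use car[OF G] in \<open>auto simp: piggyback_set_def\<close>)
      \<comment> \<open>A second pair \<open>(l, j)\<close> in this set would give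
        \<open>p l j = p l m\<close> and hence \<open>j = m\<close>. So all remaining summands come
        from surviving parity nodes and agree by \<open>node\<close>.\<close>
      have R: "?R F = ?R G"
      proof (rule finsum_vec_cong)
        fix x assume x: "x \<in> piggyback_set r p ?q - {(l, m)}"
        obtain i j where ij: "x = (i, j)" by (cases x)
        with x have b: "i < r" "j < r - 1" "p i j = ?q" "(i, j) \<noteq> (l, m)"
          by (auto simp: piggyback_set_def)
        have "j < r" using b(2) by simp
        then have "i \<noteq> l"
          using b m inj_onD[OF pl(2), of j m] by auto
        then show "(case x of (i, j) \<Rightarrow> msr_node k \<alpha>' C (F j) (k + i))
            = (case x of (i, j) \<Rightarrow> msr_node k \<alpha>' C (G j) (k + i))"
          using b ij node by simp
        show "(case x of (i, j) \<Rightarrow> msr_node k \<alpha>' C (G j) (k + i)) \<in> carrier_vec \<alpha>'"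
          using b ij car[OF G] by simp
      qed
      have "msr_node k \<alpha>' C (F m) (k + l) + ?R G = msr_node k \<alpha>' C (G m) (k + l) + ?R G"
        using P_other[OF q] R piggyback_remove[OF code F lm] piggyback_remove[OF code G lm] by simp
      then show ?thesis
        by (rule add_right_cancel_vec) (use car[OF F] car[OF G] l m R_car in auto)
    qed
    \<comment> \<open>In the first \<open>r - 1\<close> instances all parity symbols agree by now:
      by \<open>node\<close> for \<open>i \<noteq> l\<close> and by \<open>inst\<close> for
      \<open>i = l\<close>.\<close>
    have P_self: "piggyback k r \<alpha>' C p F l = piggyback k r \<alpha>' C p G l"
      unfolding piggyback_def
    proof (rule finsum_vec_cong)
      fix x assume "x \<in> piggyback_set r p l"
      then obtain i j where x: "x = (i, j)" "i < r" "j < r - 1" by (auto simp: piggyback_set_def)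
      then show "(case x of (i, j) \<Rightarrow> msr_node k \<alpha>' C (F j) (k + i))
          = (case x of (i, j) \<Rightarrow> msr_node k \<alpha>' C (G j) (k + i))"
        using node inst by (cases "i = l") auto
      show "(case x of (i, j) \<Rightarrow> msr_node k \<alpha>' C (G j) (k + i)) \<in> carrier_vec \<alpha>'"
        using x car[OF G] by simp
    qed
    show "piggybacked_node k r \<alpha>' C p F (k + l) = piggybacked_node k r \<alpha>' C p G (k + l)"
      unfolding piggybacked_node_eq
      by (rule concat_vecs_eqI) (use inst P_self in \<open>simp add: piggybacked_block_def\<close>)
  qed
  moreover have "repair_bandwidth (k + r) (k + l) D = k * \<alpha>' + (r - 1) * (r * \<alpha>')"
  proof -
    \<comment> \<open>Systematic survivors send one block of \<alpha>' symbols each; the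
      \<open>r - 1\<close> parity survivors send their entire content.\<close>
    have split: "{..<k + r} - {k + l} = {..<k} \<union> ({k..<k + r} - {k + l})" by auto
    have "repair_bandwidth (k + r) (k + l) D
        = (\<Sum>j<k. dim_row (D j)) + (\<Sum>j\<in>{k..<k + r} - {k + l}. dim_row (D j))"
      unfolding repair_bandwidth_def split by (rule sum.union_disjoint) auto
    also have "\<dots> = (\<Sum>j<k. \<alpha>') + (\<Sum>j\<in>{k..<k + r} - {k + l}. r * \<alpha>')"
      by (intro arg_cong2[where f = "(+)"] sum.cong) (auto simp: D_def block_select_mat_def)
    also have "\<dots> = k * \<alpha>' + (r - 1) * (r * \<alpha>')" using l by simp
    finally show ?thesis .
  qed
  ultimately show ?thesis by blast
qed

section \<open>Bandwidths as real numbers and the asymptotic ratio\<close>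

theorem theorem2:
  fixes C :: "nat \<Rightarrow> nat \<Rightarrow> 'a::{field,finite} mat"
    and p :: "nat \<Rightarrow> nat \<Rightarrow> nat"
    and k r \<alpha> \<alpha>' :: nat
  assumes "k \<ge> 1" and "r \<ge> 2"
    and "systematic_msr_code k r \<alpha>' C"
    and "piggyback_maps r p"
    and "\<alpha> = r * \<alpha>'"
  shows "(\<forall>i<k. \<exists>D.
            repair_scheme (piggybacked_data k r \<alpha>') (k + r) \<alpha> (piggybacked_node k r \<alpha>' C p) i D \<and>
            real (repair_bandwidth (k + r) i D) = (real k + real r - 1) * real \<alpha> / real r \<and>
            real (repair_bandwidth (k + r) i D) = optimal_bandwidth k r \<alpha>)
       \<and> (\<forall>l<r. \<exists>D.
            repair_scheme (piggybacked_data k r \<alpha>') (k + r) \<alpha> (piggybacked_node k r \<alpha>' C p) (k + l) D \<and>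
            real (repair_bandwidth (k + r) (k + l) D)
              = (real k + real r * (real r - 1)) * real \<alpha> / real r)
       \<and> (\<forall>A :: nat \<Rightarrow> nat. (\<forall>n. A n > 0) \<longrightarrow>
            (\<lambda>n. ((real n + real r * (real r - 1)) * real (A n) / real r)
                  / optimal_bandwidth n r (A n)) \<longlonglongrightarrow> 1)"
proof (intro conjI allI impI)
  fix i assume "i < k"
  from systematic_repair[OF assms(3) this, of p] assms(2)
  obtain D where "repair_scheme (piggybacked_data k r \<alpha>') (k + r) (r * \<alpha>')
      (piggybacked_node k r \<alpha>' C p) i D" "repair_bandwidth (k + r) i D = (k + r - 1) * \<alpha>'"
    by auto
  with assms(2,5) show "\<exists>D. repair_scheme (piggybacked_data k r \<alpha>') (k + r) \<alpha>
      (piggybacked_node k r \<alpha>' C p) i D \<and>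
      real (repair_bandwidth (k + r) i D) = (real k + real r - 1) * real \<alpha> / real r \<and>
      real (repair_bandwidth (k + r) i D) = optimal_bandwidth k r \<alpha>"
    by (intro exI[of _ D]) (simp add: optimal_bandwidth_def of_nat_diff)
next
  fix l assume "l < r"
  from parity_repair[OF assms(3,4) this]
  obtain D where "repair_scheme (piggybacked_data k r \<alpha>') (k + r) (r * \<alpha>')
      (piggybacked_node k r \<alpha>' C p) (k + l) D"
    "repair_bandwidth (k + r) (k + l) D = k * \<alpha>' + (r - 1) * (r * \<alpha>')"
    by auto
  moreover have "real (k * \<alpha>' + (r - 1) * (r * \<alpha>'))
      = (real k + real r * (real r - 1)) * real \<alpha> / real r"
  proof -
    \<comment> \<open>Writing \<open>r\<close> as a successor removes the truncated subtraction
      before the passage to real numbers.\<close>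
    obtain s where "r = Suc s" using assms(2) by (cases r) auto
    then show ?thesis using assms(5) by (simp add: field_simps)
  qed
  ultimately show "\<exists>D. repair_scheme (piggybacked_data k r \<alpha>') (k + r) \<alpha>
      (piggybacked_node k r \<alpha>' C p) (k + l) D \<and>
      real (repair_bandwidth (k + r) (k + l) D) = (real k + real r * (real r - 1)) * real \<alpha> / real r"
    using assms(5) by metis
next
  fix A :: "nat \<Rightarrow> nat"
  assume A: "\<forall>n. A n > 0"
  \<comment> \<open>The node size may vary with \<open>n\<close>, but the positive factor
    \<open>real (A n) / real r\<close> cancels in the ratio.\<close>
  have "((real n + real r * (real r - 1)) * real (A n) / real r) / optimal_bandwidth n r (A n)
      = (real n + real r * (real r - 1)) / (real n + real r - 1)" for n
  proof -
    have "A n > 0" using A by simp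
    with assms(2) show ?thesis by (simp add: optimal_bandwidth_def)
  qed
  \<comment> \<open>For fixed \<open>r\<close>, numerator and denominator both differ from
    \<open>n\<close> by a constant.\<close>
  moreover have "(\<lambda>n. (real n + real r * (real r - 1)) / (real n + real r - 1)) \<longlonglongrightarrow> 1"
    by real_asymp
  ultimately show "(\<lambda>n. ((real n + real r * (real r - 1)) * real (A n) / real r)
      / optimal_bandwidth n r (A n)) \<longlonglongrightarrow> 1"
    by simp
qed

end
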